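(* Let $\sigma_w^2>0$ and $\epsilon\in(0,0.5]$. For each integer $N\ge 1$ let $P^{\ast}(N)$ be the maximum allowable transmit power per channel use, i.e. the largest $P\ge 0$ such that $\mathcal{D}(\mathbb{P}_0\,\|\,\mathbb{P}_1)\le 2\epsilon^2$ when all $N$ channel uses are utilized. Then $P^{\ast}(N)$ decreases (strictly) as the integer $N\ge 1$ increases, while the maximum allowable total transmit power over the entire block, $N P^{\ast}(N)$, increases (strictly) as the integer $N\ge 1$ increases.
   Context: A warden Willie observes $N$ symbols through additive white Gaussian noise $\mathcal{CN}(0,\sigma_w^2)$. $\mathbb{P}_0$ is the joint law of Willie's $N$ observations when the transmitter is silent ($N$ i.i.d. $\mathcal{CN}(0,\sigma_w^2)$ variables), and $\mathbb{P}_1$ is the joint law when the transmitter sends i.i.d. $\mathcal{CN}(0,P)$ symbols independent of the noise ($N$ i.i.d. $\mathcal{CN}(0,P+\sigma_w^2)$ variables), where $\mathcal{CN}(0,\sigma^2)$ is the circularly-symmetric complex normal distribution with mean $0$ and variance $\sigma^2$. $\mathcal{D}(\mathbb{P}_0\,\|\,\mathbb{P}_1)$ is the Kullback–Leibler divergence (in nats), which equals $$\mathcal{D}(\mathbb{P}_0\,\|\,\mathbb{P}_1)=N\left[\ln\left(\frac{P+\sigma_w^2}{\sigma_w^2}\right)-\frac{P}{P+\sigma_w^2}\right].$$ *)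

theory Defs
  imports "HOL-Probability.Probability"
begin

text \<open>
  The circularly-symmetric complex normal law of mean zero and variance \<open>v > 0\<close>:
  real and imaginary parts are independent real normals of variance \<open>v / 2\<close> each.
  The parameter is the variance, not the standard deviation.
\<close>
definition complex_normal :: "real \<Rightarrow> complex measure" where
  "complex_normal v =
     density lborel (\<lambda>z. ennreal (exp (- (cmod z)\<^sup>2 / v) / (pi * v)))"

definition iid_complex_normal :: "nat \<Rightarrow> real \<Rightarrow> (nat \<Rightarrow> complex) measure" where
  "iid_complex_normal N v = (\<Pi>\<^sub>M i\<in>{..<N}. complex_normal v)"

definition law_silent :: "real \<Rightarrow> nat \<Rightarrow> (nat \<Rightarrow> complex) measure" where
  "law_silent \<sigma>w N = iid_complex_normal N (\<sigma>w\<^sup>2)"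

definition law_transmit :: "real \<Rightarrow> nat \<Rightarrow> real \<Rightarrow> (nat \<Rightarrow> complex) measure" where
  "law_transmit \<sigma>w N P = iid_complex_normal N (P + \<sigma>w\<^sup>2)"

text \<open>
  \<open>KL_divergence b M N\<close> integrates \<open>log b\<close> of the derivative of \<open>N\<close> with respect to \<open>M\<close>
  against \<open>N\<close>, so it is the divergence of \<open>N\<close> from \<open>M\<close>: the arguments are in the
  reverse of the customary order. Base \<open>exp 1\<close> gives nats.
\<close>
definition silent_transmit_divergence :: "real \<Rightarrow> nat \<Rightarrow> real \<Rightarrow> real" where
  "silent_transmit_divergence \<sigma>w N P =
     KL_divergence (exp 1) (law_transmit \<sigma>w N P) (law_silent \<sigma>w N)"

definition max_power :: "real \<Rightarrow> real \<Rightarrow> nat \<Rightarrow> real" where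
  "max_power \<sigma>w \<epsilon> N =
     (GREATEST P. 0 \<le> P \<and> silent_transmit_divergence \<sigma>w N P \<le> 2 * \<epsilon>\<^sup>2)"

end

theory Submission
  imports Defs
begin

text \<open>
  The divergence is \<open>N g(P / \<sigma>w\<^sup>2)\<close> with \<open>g(x) = ln (1 + x) - x / (1 + x)\<close> strictly increasing
  and unbounded, so \<open>max_power \<sigma>w \<epsilon> N = \<sigma>w\<^sup>2 x\<^sub>N\<close> where \<open>g(x\<^sub>N) = 2 \<epsilon>\<^sup>2 / N\<close>; hence \<open>x\<^sub>N\<close>
  decreases. As \<open>N x\<^sub>N = 2 \<epsilon>\<^sup>2 x\<^sub>N / g(x\<^sub>N)\<close>, the total power increases as long as
  \<open>g(x) / x\<close> increases in \<open>x\<close>. This holds on \<open>(0, 5/4]\<close>, which contains \<open>x\<^sub>N\<close> for \<open>N \<ge> 2\<close>,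
  but not at \<open>x\<^sub>1\<close> when \<open>\<epsilon> = 1/2\<close>. The step from \<open>N = 1\<close> to \<open>N = 2\<close> instead uses
  \<open>g(x\<^sub>1) = 2 g(x\<^sub>2) < g(2 x\<^sub>2)\<close>.
\<close>

section \<open>The Gaussian divergence\<close>

text \<open>Lebesgue measure on the complex plane is a product over the basis 1,
  \<open>\<i>\<close>, so Tonelli splits off the real and imaginary parts.\<close>

lemma nn_integral_lborel_complex:
  assumes [measurable]: "f \<in> borel_measurable borel" "g \<in> borel_measurable borel"
  shows "(\<integral>\<^sup>+z. f (Re z) * g (Im z) \<partial>lborel) = (\<integral>\<^sup>+x. f x \<partial>lborel) * (\<integral>\<^sup>+x. g x \<partial>lborel)"
proof -
  let ?h = "\<lambda>b::complex. if b = 1 then f else g"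
  have "(\<integral>\<^sup>+z. (\<Prod>b\<in>Basis. ?h b (z \<bullet> b)) \<partial>lborel) = (\<Prod>b\<in>Basis. (\<integral>\<^sup>+x. ?h b x \<partial>lborel))"
    by (rule nn_integral_lborel_prod) auto
  then show ?thesis
    by (simp add: Basis_complex_def complex_i_not_one)
qed

text \<open>The density is kept real-valued, since \<open>KL_density_density\<close> works with real
  densities.\<close>

definition complex_normal_density :: "real \<Rightarrow> complex \<Rightarrow> real" where
  "complex_normal_density v z = exp (- (cmod z)\<^sup>2 / v) / (pi * v)"

lemma complex_normal_eq_density:
  "complex_normal v = density lborel (complex_normal_density v)"
  by (simp add: complex_normal_def complex_normal_density_def)

lemma complex_normal_density_pos: "v > 0 \<Longrightarrow> complex_normal_density v z > 0"
  by (simp add: complex_normal_density_def)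

lemma borel_measurable_complex_normal_density [measurable]:
  "complex_normal_density v \<in> borel_measurable borel"
  unfolding complex_normal_density_def by measurable

lemma complex_normal_density_eq_prod:
  assumes "v > 0"
  shows "complex_normal_density v z =
    normal_density 0 (sqrt (v / 2)) (Re z) * normal_density 0 (sqrt (v / 2)) (Im z)"
  using assms
  by (simp add: complex_normal_density_def normal_density_def cmod_power2 exp_add [symmetric]
      diff_divide_distrib)

lemma prob_space_complex_normal:
  assumes "v > 0"
  shows "prob_space (complex_normal v)"
proof
  let ?d = "normal_density 0 (sqrt (v / 2))"
  have d: "(\<integral>\<^sup>+x. ennreal (?d x) \<partial>lborel) = 1"
    using assms by (subst nn_integral_eq_integral) (auto intro: integrable_normal_density)
  have "(\<integral>\<^sup>+z. ennreal (complex_normal_density v z) \<partial>lborel)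
      = (\<integral>\<^sup>+z. ennreal (?d (Re z)) * ennreal (?d (Im z)) \<partial>lborel)"
    using assms by (simp add: complex_normal_density_eq_prod ennreal_mult)
  also have "\<dots> = 1"
    by (subst nn_integral_lborel_complex) (auto simp: d)
  finally show "emeasure (complex_normal v) (space (complex_normal v)) = 1"
    by (simp add: complex_normal_eq_density emeasure_density)
qed

text \<open>With |z|^2 = (Re z)^2 + (Im z)^2, each summand factors into a real second moment v/2 and
  a total mass 1. This is the one moment that the divergence needs, as the log-likelihood ratio is
  affine in |z|^2.\<close>

lemma complex_normal_second_moment:
  assumes "v > 0"
  shows "has_bochner_integral (complex_normal v) (\<lambda>z. (cmod z)\<^sup>2) v"
proof -
  let ?d = "normal_density 0 (sqrt (v / 2))"
  have s: "0 < sqrt (v / 2)"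
    using assms by simp
  have d: "(\<integral>\<^sup>+x. ennreal (?d x) \<partial>lborel) = 1"
    using s by (subst nn_integral_eq_integral) (auto intro: integrable_normal_density)
  have m: "has_bochner_integral lborel (\<lambda>x. ?d x * x\<^sup>2) (v / 2)"
    using normal_moment_even [OF s, of 0 1] assms by simp
  have d2: "(\<integral>\<^sup>+x. ennreal (?d x * x\<^sup>2) \<partial>lborel) = ennreal (v / 2)"
    using m
    by (subst nn_integral_eq_integral)
      (auto simp: has_bochner_integral_integral_eq [OF m] intro: integrable.intros)
  have "(\<integral>\<^sup>+z. ennreal (complex_normal_density v z * (cmod z)\<^sup>2) \<partial>lborel)
      = (\<integral>\<^sup>+z. ennreal (?d (Re z) * (Re z)\<^sup>2) * ennreal (?d (Im z))
            + ennreal (?d (Re z)) * ennreal (?d (Im z) * (Im z)\<^sup>2) \<partial>lborel)"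
    using assms
    by (intro nn_integral_cong)
      (simp add: complex_normal_density_eq_prod cmod_power2 algebra_simps
        flip: ennreal_mult ennreal_plus)
  also have "\<dots> = ennreal v"
    using assms
      nn_integral_lborel_complex [of "\<lambda>x. ennreal (?d x * x\<^sup>2)" "\<lambda>x. ennreal (?d x)"]
      nn_integral_lborel_complex [of "\<lambda>x. ennreal (?d x)" "\<lambda>x. ennreal (?d x * x\<^sup>2)"]
    by (subst nn_integral_add) (simp_all add: d d2 flip: ennreal_plus)
  finally have "has_bochner_integral lborel (\<lambda>z. complex_normal_density v z * (cmod z)\<^sup>2) v"
    using assms by (intro has_bochner_integral_nn_integral) (auto simp: complex_normal_density_def)
  then show ?thesis
    unfolding complex_normal_eq_density using complex_normal_density_pos [OF assms]
    by (intro has_bochner_integral_density) (auto intro: less_imp_le)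
qed

section \<open>Joint densities and the divergence of the i.i.d. laws\<close>

lemma (in product_sigma_finite) PiM_density:
  assumes "finite I"
    and f [measurable]: "\<And>i. f i \<in> borel_measurable (M i)"
    and prob: "\<And>i. prob_space (density (M i) (f i))"
  shows "Pi\<^sub>M I (\<lambda>i. density (M i) (f i)) = density (Pi\<^sub>M I M) (\<lambda>x. \<Prod>i\<in>I. f i (x i))"
proof -
  interpret D: product_prob_space "\<lambda>i. density (M i) (f i)"
    by (intro product_prob_spaceI prob)
  have sets_eq: "sets (density (Pi\<^sub>M I M) (\<lambda>x. \<Prod>i\<in>I. f i (x i))) = sets (Pi\<^sub>M I (\<lambda>i. density (M i) (f i)))"
    unfolding sets_density by (intro sets_PiM_cong) auto
  show ?thesis
  \<comment> \<open>A product measure is determined by its values on boxes, so it suffices to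
    compare these.\<close>
  proof (rule D.PiM_eqI [symmetric, OF assms(1) sets_eq])
    fix A assume "\<And>i. i \<in> I \<Longrightarrow> A i \<in> sets (density (M i) (f i))"
    then have [measurable]: "\<And>i. i \<in> I \<Longrightarrow> A i \<in> sets (M i)"
      by simp
    have "emeasure (density (Pi\<^sub>M I M) (\<lambda>x. \<Prod>i\<in>I. f i (x i))) (Pi\<^sub>E I A)
        = (\<integral>\<^sup>+x. (\<Prod>i\<in>I. f i (x i)) * indicator (Pi\<^sub>E I A) x \<partial>Pi\<^sub>M I M)"
      using assms(1) by (intro emeasure_density) auto
    \<comment> \<open>Outside the box some coordinate indicator is 0, which kills the whole
      product.\<close>
    also have "\<dots> = (\<integral>\<^sup>+x. (\<Prod>i\<in>I. f i (x i) * indicator (A i) (x i)) \<partial>Pi\<^sub>M I M)"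
      using assms(1)
      by (intro nn_integral_cong)
        (auto simp: prod.distrib space_PiM PiE_iff split: split_indicator intro!: prod_zero)
    also have "\<dots> = (\<Prod>i\<in>I. \<integral>\<^sup>+x. f i x * indicator (A i) x \<partial>M i)"
      using assms(1) by (intro product_nn_integral_prod) auto
    also have "\<dots> = (\<Prod>i\<in>I. emeasure (density (M i) (f i)) (A i))"
      by (intro prod.cong) (auto simp: emeasure_density)
    finally show "emeasure (density (Pi\<^sub>M I M) (\<lambda>x. \<Prod>i\<in>I. f i (x i))) (Pi\<^sub>E I A)
      = (\<Prod>i\<in>I. emeasure (density (M i) (f i)) (A i))" .
  qed
qed

lemma iid_complex_normal_eq_density:
  assumes "v > 0"
  shows "iid_complex_normal N v =
    density (\<Pi>\<^sub>M i\<in>{..<N}. lborel) (\<lambda>x. ennreal (\<Prod>i<N. complex_normal_density v (x i)))"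
proof -
  interpret product_sigma_finite "\<lambda>_::nat. lborel :: complex measure" ..
  show ?thesis
    unfolding iid_complex_normal_def complex_normal_eq_density
    using assms prob_space_complex_normal [OF assms] complex_normal_density_pos [OF assms]
    by (subst PiM_density)
      (auto simp: complex_normal_eq_density prod_ennreal less_imp_le)
qed

text \<open>Here \<open>v\<close> is the variance of the law integrated against (silent) and
  \<open>w\<close> that of the reference law (transmitting). The log-likelihood ratio is a sum over
  coordinates of affine functions of |x_i|^2, each of whose expectations follows from the second
  moment v.\<close>

lemma KL_divergence_iid_complex_normal:
  assumes v: "v > 0" and w: "w > 0"
  shows "KL_divergence (exp 1) (iid_complex_normal N w) (iid_complex_normal N v)
    = real N * (ln (w / v) + v / w - 1)"
proof -
  interpret product_sigma_finite "\<lambda>_::nat. lborel :: complex measure" ..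
  interpret L: finite_product_sigma_finite "\<lambda>_::nat. lborel :: complex measure" "{..<N}"
    by standard simp
  let ?p = "\<lambda>v x. \<Prod>i<N. complex_normal_density v (x i)"
  let ?L = "\<Pi>\<^sub>M i\<in>{..<N}. (lborel :: complex measure)"
  have pos: "?p u x > 0" if "u > 0" for u and x :: "nat \<Rightarrow> complex"
    using complex_normal_density_pos [OF that] by (intro prod_pos) auto
  have nonneg: "AE x in ?L. 0 \<le> ?p u x" if "u > 0" for u
    using pos [OF that] by (auto intro!: always_eventually less_imp_le)
  have meas [measurable]: "?p u \<in> borel_measurable ?L" for u
    by measurable
  have ln_ratio: "ln (?p v x / ?p w x)
      = (\<Sum>i<N. ln (w / v) + (1 / w - 1 / v) * (cmod (x i))\<^sup>2)" for x
  proof -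
    have "ln (?p v x / ?p w x) = (\<Sum>i<N. ln (complex_normal_density v (x i) / complex_normal_density w (x i)))"
      unfolding prod_dividef [symmetric]
      using complex_normal_density_pos [OF v] complex_normal_density_pos [OF w]
      by (intro ln_prod) (auto simp: less_le)
    also have "\<dots> = (\<Sum>i<N. ln (w / v) + (1 / w - 1 / v) * (cmod (x i))\<^sup>2)"
      using v w
      by (intro sum.cong)
        (auto simp: complex_normal_density_def ln_div ln_mult algebra_simps)
    finally show ?thesis .
  qed
  have component: "has_bochner_integral (iid_complex_normal N v)
      (\<lambda>x. ln (w / v) + (1 / w - 1 / v) * (cmod (x i))\<^sup>2) (ln (w / v) + (1 / w - 1 / v) * v)"
    if i: "i < N" for i
  proof -
    interpret prob_space "complex_normal v"
      by (rule prob_space_complex_normal [OF v])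
    have "has_bochner_integral (complex_normal v)
        (\<lambda>z. ln (w / v) + (1 / w - 1 / v) * (cmod z)\<^sup>2) (ln (w / v) + (1 / w - 1 / v) * v)"
      using complex_normal_second_moment [OF v] by (simp add: has_bochner_integral_iff prob_space)
    \<comment> \<open>The marginal of the product is the single-symbol law, which moves the
      expectation to one symbol.\<close>
    moreover have "complex_normal v = distr (iid_complex_normal N v) (complex_normal v) (\<lambda>x. x i)"
      unfolding iid_complex_normal_def
      by (rule distr_PiM_component [symmetric]) (use i v prob_space_complex_normal in auto)
    ultimately have "has_bochner_integral (distr (iid_complex_normal N v) (complex_normal v) (\<lambda>x. x i))
        (\<lambda>z. ln (w / v) + (1 / w - 1 / v) * (cmod z)\<^sup>2) (ln (w / v) + (1 / w - 1 / v) * v)"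
      by simp
    moreover have "(\<lambda>x. x i) \<in> iid_complex_normal N v \<rightarrow>\<^sub>M complex_normal v"
      unfolding iid_complex_normal_def using i by (intro measurable_component_singleton) auto
    moreover have "(\<lambda>z. ln (w / v) + (1 / w - 1 / v) * (cmod z)\<^sup>2) \<in> borel_measurable (complex_normal v)"
      by (simp add: complex_normal_eq_density)
    ultimately show ?thesis
      by (simp add: has_bochner_integral_iff integrable_distr_eq integral_distr)
  qed
  have "KL_divergence (exp 1) (iid_complex_normal N w) (iid_complex_normal N v)
      = (\<integral>x. ?p v x * log (exp 1) (?p v x / ?p w x) \<partial>?L)"
    unfolding iid_complex_normal_eq_density [OF v] iid_complex_normal_eq_density [OF w]
    using pos [OF w] by (intro L.KL_density_density nonneg v w meas) (auto simp: less_le)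
  also have "\<dots> = (\<integral>x. ln (?p v x / ?p w x) \<partial>iid_complex_normal N v)"
    unfolding iid_complex_normal_eq_density [OF v]
    by (subst integral_real_density) (use nonneg [OF v] in \<open>auto simp: log_def\<close>)
  also have "\<dots> = (\<Sum>i<N. ln (w / v) + (1 / w - 1 / v) * v)"
    unfolding ln_ratio
    by (intro has_bochner_integral_integral_eq has_bochner_integral_sum component) auto
  also have "\<dots> = real N * (ln (w / v) + v / w - 1)"
    using v w by (simp add: field_simps)
  finally show ?thesis .
qed

section \<open>The divergence per channel use\<close>

text \<open>The argument is the signal-to-noise ratio P / \<sigma>w^2, so the noise level disappears
  from the analysis.\<close>

definition snr_divergence :: "real \<Rightarrow> real" where
  "snr_divergence x = ln (1 + x) - x / (1 + x)"

lemma silent_transmit_divergence_eq: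
  assumes "\<sigma>w\<^sup>2 > 0" "P \<ge> 0"
  shows "silent_transmit_divergence \<sigma>w N P = real N * snr_divergence (P / \<sigma>w\<^sup>2)"
proof -
  have 1: "1 + P / \<sigma>w\<^sup>2 = (P + \<sigma>w\<^sup>2) / \<sigma>w\<^sup>2"
    using assms by (simp add: field_simps)
  have pos: "P + \<sigma>w\<^sup>2 > 0"
    using assms by (intro add_nonneg_pos)
  have "silent_transmit_divergence \<sigma>w N P
      = real N * (ln ((P + \<sigma>w\<^sup>2) / \<sigma>w\<^sup>2) + \<sigma>w\<^sup>2 / (P + \<sigma>w\<^sup>2) - 1)"
    unfolding silent_transmit_divergence_def law_silent_def law_transmit_def
    by (rule KL_divergence_iid_complex_normal [OF assms(1) pos])
  moreover have "\<sigma>w\<^sup>2 / (P + \<sigma>w\<^sup>2) - 1 = - (P / \<sigma>w\<^sup>2) / (1 + P / \<sigma>w\<^sup>2)"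
    unfolding 1 using assms pos by (simp add: divide_simps)
  ultimately show ?thesis
    by (simp add: snr_divergence_def 1)
qed

lemma snr_divergence_0 [simp]: "snr_divergence 0 = 0"
  by (simp add: snr_divergence_def)

lemma has_real_derivative_snr_divergence:
  assumes "x > -1"
  shows "(snr_divergence has_real_derivative x / (1 + x)\<^sup>2) (at x)"
proof -
  have eq: "1 / (1 + x) - (1 * (1 + x) - x * 1) / ((1 + x) * (1 + x)) = x / (1 + x)\<^sup>2"
    using assms by (simp add: divide_simps) (simp add: power2_eq_square algebra_simps)
  show ?thesis
    unfolding snr_divergence_def eq [symmetric]
    using assms by (auto intro!: derivative_eq_intros)
qed

lemmas has_real_derivative_snr_divergence' [derivative_intros] =
  DERIV_chain2 [OF has_real_derivative_snr_divergence]

lemma continuous_on_snr_divergence: "continuous_on {0..} snr_divergence"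
  by (rule continuous_at_imp_continuous_on)
    (auto intro!: DERIV_isCont has_real_derivative_snr_divergence)

text \<open>The derivative t/(1+t)^2 vanishes at t = 0, hence the monotonicity rule that asks for
  positivity on the open interval.\<close>

lemma snr_divergence_strict_mono:
  assumes "0 \<le> x" "x < y"
  shows "snr_divergence x < snr_divergence y"
proof (rule DERIV_pos_imp_increasing_open [OF assms(2)])
  fix t assume "x < t" "t < y"
  then show "\<exists>d. (snr_divergence has_real_derivative d) (at t) \<and> d > 0"
    using assms has_real_derivative_snr_divergence [of t]
    by (intro exI [of _ "t / (1 + t)\<^sup>2"]) auto
qed (use assms in \<open>auto intro: continuous_on_subset [OF continuous_on_snr_divergence]\<close>)

lemma snr_divergence_less_iff:
  assumes "0 \<le> x" "0 \<le> y"
  shows "snr_divergence x < snr_divergence y \<longleftrightarrow> x < y"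
  using assms snr_divergence_strict_mono [of x y] snr_divergence_strict_mono [of y x]
  by (cases x y rule: linorder_cases) auto

lemma snr_divergence_surj:
  assumes "c \<ge> 0"
  obtains x where "x \<ge> 0" "snr_divergence x = c"
proof -
  \<comment> \<open>Since x/(1+x) is at most 1, the value at x is at least ln (1+x) - 1, and this is
    at least c at x = exp (c+1). The intermediate value theorem then applies between 0 and this
    point.\<close>
  let ?X = "exp (c + 1)"
  have "c + 1 = ln ?X"
    by simp
  also have "\<dots> \<le> ln (1 + ?X)"
    by (subst ln_le_cancel_iff) (auto simp: add_pos_pos)
  finally have "c + 1 \<le> ln (1 + ?X)" .
  moreover have "?X / (1 + ?X) \<le> 1"
    by (simp add: add_pos_pos)
  ultimately have "c \<le> snr_divergence ?X"
    by (simp add: snr_divergence_def)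
  then have "\<exists>x\<ge>0. x \<le> ?X \<and> snr_divergence x = c"
    using assms
    by (intro IVT') (auto intro: continuous_on_subset [OF continuous_on_snr_divergence])
  then show ?thesis
    using that by blast
qed

section \<open>Numerical bounds and inequalities on (0, 5/4]\<close>

lemma ln_9_4_bounds: "29 / 36 < ln (9 / 4 :: real)" "ln (9 / 4 :: real) < 70 / 81"
proof -
  \<comment> \<open>As \<open>snr_divergence (5 / 4)\<close> is ln (9/4) - 5/9, the bounds are 1/4 +
    5/9 and (5/9)^2 + 5/9. Passing to 3/2 brings the logarithm's argument nearer to 1, where the
    series bounds are tighter.\<close>
  have "ln (9 / 4 :: real) = ln ((3 / 2)\<^sup>2)"
    by (simp add: power2_eq_square)
  also have "\<dots> = 2 * ln (3 / 2)"
    by (subst ln_realpow) auto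
  finally show "29 / 36 < ln (9 / 4 :: real)" "ln (9 / 4 :: real) < 70 / 81"
    using ln_approx_bounds [of "3 / 2" 2] by (auto simp: eval_nat_numeral)
qed

text \<open>The threshold 1/4 is the largest possible value of 2 \<epsilon>^2 / N for N \<ge> 2,
  attained at \<epsilon> = 1/2 and N = 2.\<close>

lemma snr_divergence_5_4: "1 / 4 < snr_divergence (5 / 4)"
  using ln_9_4_bounds by (simp add: snr_divergence_def)

text \<open>
  This bound and the next fail for large \<open>x\<close>. Each difference first increases from \<open>0\<close>
  and then decreases, so it suffices to check the right endpoint.
\<close>
lemma snr_divergence_double:
  assumes "0 < x" "x \<le> 5 / 4"
  shows "2 * snr_divergence x < snr_divergence (2 * x)"
proof -
  let ?h = "\<lambda>x. snr_divergence (2 * x) - 2 * snr_divergence x"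
  \<comment> \<open>In this factored form the sign for positive x is that of 1 - 2 x^2, which is
    where the case split below comes from.\<close>
  let ?h' = "\<lambda>x::real. 2 * x * (1 - 2 * x\<^sup>2) * (1 / ((1 + 2 * x)\<^sup>2 * (1 + x)\<^sup>2))"
  have deriv: "(?h has_real_derivative ?h' t) (at t)" if "t \<ge> 0" for t
  proof -
    have "(1 + t) \<noteq> 0" "(1 + 2 * t) \<noteq> 0"
      using that by auto
    then have eq: "2 * t / (1 + 2 * t)\<^sup>2 * 2 - 2 * (t / (1 + t)\<^sup>2) = ?h' t"
      by (simp add: divide_simps) (simp add: power2_eq_square algebra_simps)
    show ?thesis
      unfolding eq [symmetric]
      by (rule derivative_eq_intros refl | use that in simp)+
  qed
  have cont: "continuous_on {a..b} ?h" if "a \<ge> 0" for a b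
    by (rule continuous_at_imp_continuous_on) (use that in \<open>auto intro!: DERIV_isCont [OF deriv]\<close>)
  have "0 < ?h x"
  proof (cases "2 * x\<^sup>2 \<le> 1")
    case True
    have "?h 0 < ?h x"
    proof (rule DERIV_pos_imp_increasing_open [OF \<open>0 < x\<close> _ cont])
      fix t assume t: "0 < t" "t < x"
      then have "t\<^sup>2 < x\<^sup>2"
        by (intro power_strict_mono) auto
      then have "?h' t > 0"
        using t True by (intro mult_pos_pos divide_pos_pos zero_less_power) auto
      then show "\<exists>d. (?h has_real_derivative d) (at t) \<and> d > 0"
        using deriv [of t] t by auto
    qed auto
    then show ?thesis
      by simp
  next
    case False
    have "?h (5 / 4) \<le> ?h x"
    proof (rule DERIV_nonpos_imp_nonincreasing [OF assms(2)])
      fix t assume t: "x \<le> t" "t \<le> 5 / 4"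
      then have "x\<^sup>2 \<le> t\<^sup>2"
        using assms by (intro power_mono) auto
      then have "2 * t * (1 - 2 * t\<^sup>2) \<le> 0"
        using t assms False by (intro mult_nonneg_nonpos) linarith+
      then have "?h' t \<le> 0"
        by (rule mult_nonpos_nonneg) simp
      then show "\<exists>d. (?h has_real_derivative d) (at t) \<and> d \<le> 0"
        using deriv [of t] t assms by auto
    qed
    moreover have "0 < ?h (5 / 4)"
    proof -
      \<comment> \<open>The endpoint value is 25/63 - ln (81/56), because 10/9 - 5/7 = 25/63 and
        (9/4)^2 / (7/2) = 81/56. Merging the logarithms leaves a single one to estimate.\<close>
      have "ln (9 / 4 * (9 / 4)) = ln (7 / 2 * (81 / 56 :: real))"
        by simp
      then have "2 * ln (9 / 4 :: real) = ln (7 / 2) + ln (81 / 56)"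
        by (subst (asm) ln_mult, simp, simp, subst (asm) ln_mult) auto
      moreover have "ln (81 / 56 :: real) < 25 / 63"
        using ln_approx_bounds [of "81 / 56" 1] by (auto simp: eval_nat_numeral)
      ultimately show ?thesis
        by (simp add: snr_divergence_def)
    qed
    ultimately show ?thesis
      by linarith
  qed
  then show ?thesis
    by simp
qed

lemma snr_divergence_less_square:
  assumes "0 < x" "x \<le> 5 / 4"
  shows "snr_divergence x < (x / (1 + x))\<^sup>2"
proof -
  let ?h = "\<lambda>x. (x / (1 + x))\<^sup>2 - snr_divergence x"
  let ?h' = "\<lambda>x::real. x * (1 - x) / (1 + x) ^ 3"
  have deriv: "(?h has_real_derivative ?h' t) (at t)" if "t \<ge> 0" for t
  proof -
    have "1 + t \<noteq> 0"
      using that by auto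
    then have "((\<lambda>x. x / (1 + x)) has_real_derivative 1 / (1 + t)\<^sup>2) (at t)"
      and eq: "2 * (t / (1 + t)) * (1 / (1 + t)\<^sup>2) - t / (1 + t)\<^sup>2 = ?h' t"
      by (auto intro!: derivative_eq_intros simp: power2_eq_square)
        (simp add: power2_eq_square power3_eq_cube divide_simps; simp add: algebra_simps)
    from DERIV_diff [OF DERIV_power [OF this(1), of 2] has_real_derivative_snr_divergence [of t]]
    show ?thesis
      unfolding eq [symmetric] using that by (simp add: mult_ac)
  qed
  have cont: "continuous_on {a..b} ?h" if "a \<ge> 0" for a b
    by (rule continuous_at_imp_continuous_on) (use that in \<open>auto intro!: DERIV_isCont [OF deriv]\<close>)
  have "0 < ?h x"
  \<comment> \<open>The derivative \<open>?h'\<close> changes sign at 1.\<close>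
  proof (cases "x \<le> 1")
    case True
    have "?h 0 < ?h x"
    proof (rule DERIV_pos_imp_increasing_open [OF \<open>0 < x\<close> _ cont])
      fix t assume t: "0 < t" "t < x"
      then have "?h' t > 0"
        using True by (intro mult_pos_pos divide_pos_pos zero_less_power) auto
      then show "\<exists>d. (?h has_real_derivative d) (at t) \<and> d > 0"
        using deriv [of t] t by auto
    qed auto
    then show ?thesis
      by simp
  next
    case False
    have "?h (5 / 4) \<le> ?h x"
    proof (rule DERIV_nonpos_imp_nonincreasing [OF assms(2)])
      fix t assume t: "x \<le> t" "t \<le> 5 / 4"
      then have "?h' t \<le> 0"
        using False by (intro divide_nonpos_nonneg mult_nonneg_nonpos) auto
      then show "\<exists>d. (?h has_real_derivative d) (at t) \<and> d \<le> 0"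
        using deriv [of t] t assms by auto
    qed
    moreover have "0 < ?h (5 / 4)"
      using ln_9_4_bounds by (simp add: snr_divergence_def power2_eq_square)
    ultimately show ?thesis
      by linarith
  qed
  then show ?thesis
    by simp
qed

text \<open>The derivative of g(t)/t has the sign of t g'(t) - g(t), and t g'(t) = (t/(1+t))^2;
  \<open>snr_divergence_less_square\<close> is exactly the positivity of this difference.\<close>

lemma snr_divergence_ratio_strict_mono:
  assumes "0 < x" "x < y" "y \<le> 5 / 4"
  shows "snr_divergence x / x < snr_divergence y / y"
proof (rule DERIV_pos_imp_increasing [OF assms(2)])
  fix t assume t: "x \<le> t" "t \<le> y"
  let ?d = "(t / (1 + t)\<^sup>2 * t - snr_divergence t) / (t * t)"
  have "((\<lambda>t. snr_divergence t / t) has_real_derivative ?d) (at t)"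
    using t assms by (auto intro!: derivative_eq_intros)
  moreover have "?d > 0"
    using snr_divergence_less_square [of t] t assms by (simp add: power_divide power2_eq_square)
  ultimately show "\<exists>d. ((\<lambda>t. snr_divergence t / t) has_real_derivative d) (at t) \<and> d > 0"
    by blast
qed

section \<open>The maximum power\<close>

text \<open>At \<open>x\<close> the constraint holds with equality, and any larger ratio violates it
  by strict monotonicity. So the maximum is attained and \<open>GREATEST\<close> is well
  defined.\<close>

lemma max_power_eq:
  assumes "\<sigma>w\<^sup>2 > 0" "x \<ge> 0" and x: "real N * snr_divergence x = 2 * \<epsilon>\<^sup>2" and "N \<ge> 1"
  shows "max_power \<sigma>w \<epsilon> N = \<sigma>w\<^sup>2 * x"
  unfolding max_power_def
proof (rule Greatest_equality)
  show "0 \<le> \<sigma>w\<^sup>2 * x \<and> silent_transmit_divergence \<sigma>w N (\<sigma>w\<^sup>2 * x) \<le> 2 * \<epsilon>\<^sup>2"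
    using assms by (auto simp: silent_transmit_divergence_eq)
next
  fix P assume P: "0 \<le> P \<and> silent_transmit_divergence \<sigma>w N P \<le> 2 * \<epsilon>\<^sup>2"
  then have "real N * snr_divergence (P / \<sigma>w\<^sup>2) \<le> real N * snr_divergence x"
    using silent_transmit_divergence_eq [OF assms(1), of P N] x by simp
  then have "snr_divergence (P / \<sigma>w\<^sup>2) \<le> snr_divergence x"
    using \<open>N \<ge> 1\<close> by simp
  then have "\<not> x < P / \<sigma>w\<^sup>2"
    using assms P by (subst snr_divergence_less_iff [symmetric]) auto
  then show "P \<le> \<sigma>w\<^sup>2 * x"
    using assms by (simp add: field_simps not_less)
qed

theorem mainTheorem2:
  fixes \<sigma>w \<epsilon> :: real
  assumes "\<sigma>w\<^sup>2 > 0"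
    and "0 < \<epsilon>" and "\<epsilon> \<le> 1 / 2"
  shows "strict_antimono_on {1..} (max_power \<sigma>w \<epsilon>)
    \<and> strict_mono_on {1..} (\<lambda>N. real N * max_power \<sigma>w \<epsilon> N)"
proof -
  define c where "c = 2 * \<epsilon>\<^sup>2"
  have "\<epsilon>\<^sup>2 \<le> (1 / 2)\<^sup>2"
    using assms by (intro power_mono) auto
  then have c: "0 < c" "c \<le> 1 / 2"
    using assms by (auto simp: c_def power2_eq_square)
  \<comment> \<open>This includes N = 0, where c / 0 = 0, so that \<open>X\<close> can be chosen
    without a side condition.\<close>
  have "\<exists>x\<ge>0. snr_divergence x = c / real N" for N
    using snr_divergence_surj [of "c / real N"] c by (metis divide_nonneg_nonneg less_imp_le of_nat_0_le_iff)
  then obtain X where X: "\<And>N. X N \<ge> 0" "\<And>N. snr_divergence (X N) = c / real N"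
    by metis
  have max_power_X: "max_power \<sigma>w \<epsilon> N = \<sigma>w\<^sup>2 * X N" if "N \<ge> 1" for N
    using that assms X by (intro max_power_eq) (auto simp: c_def)
  have X_pos: "X N > 0" if "N \<ge> 1" for N
    using X [of N] c that by (cases "X N = 0") auto
  have decreasing: "X n < X m" if "1 \<le> m" "m < n" for m n
    using that c X by (subst snr_divergence_less_iff [symmetric]) (auto simp: frac_less2)
  have X_le: "X N \<le> 5 / 4" if "N \<ge> 2" for N
  proof -
    have "c / real N \<le> (1 / 2) / 2"
      using that c by (intro frac_le) auto
    then have "snr_divergence (X N) < snr_divergence (5 / 4)"
      using snr_divergence_5_4 X [of N] by linarith
    then show ?thesis
      using X by (subst (asm) snr_divergence_less_iff) auto
  qed
  have tail: "real m * X m < real n * X n" if "2 \<le> m" "m < n" for m n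
  proof -
    have "snr_divergence (X n) / X n < snr_divergence (X m) / X m"
      using that by (intro snr_divergence_ratio_strict_mono X_pos X_le decreasing) auto
    then have "c / (real n * X n) < c / (real m * X m)"
      using X by simp
    then show ?thesis
      using c that X_pos [of m] X_pos [of n] by (simp add: divide_simps mult_less_cancel_left)
  qed
  have one_two: "real 1 * X 1 < real 2 * X 2"
  proof -
    have "snr_divergence (X 1) = 2 * snr_divergence (X 2)"
      using X by simp
    also have "\<dots> < snr_divergence (2 * X 2)"
      by (intro snr_divergence_double X_pos X_le) auto
    finally show ?thesis
      using X by (subst (asm) snr_divergence_less_iff) auto
  qed
  have increasing: "real m * X m < real n * X n" if "1 \<le> m" "m < n" for m n
  proof -
    \<comment> \<open>From m = 1 to n > 2 the comparison passes through 2, combining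
      \<open>one_two\<close> with \<open>tail\<close>.\<close>
    from that consider "2 \<le> m" | "m = 1" "n = 2" | "m = 1" "2 < n"
      by force
    then show ?thesis
      using one_two tail [of m n] tail [of 2 n] that by cases auto
  qed
  show ?thesis
    using assms(1) decreasing increasing
    by (auto intro!: monotone_onI simp: max_power_X mult.left_commute)
qed

end
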